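(* Let $\Theta$ be a nonnegative random variable with law $\mu_\Theta$, and let $X_1,\dots,X_n$ be nonnegative random variables that are conditionally independent given $\Theta$, such that for each $i$ the map $(\theta,t)\mapsto\mathbb E[e^{-tX_i}\mid\Theta=\theta]$ is jointly measurable. Suppose that, conditionally on $\Theta=\theta$, each $X_i$ has an exponential dispersion family density $$f_{X_i\mid\Theta=\theta}(x)=\exp\Big\{\frac{x\,\eta_i(\theta)-\kappa_i(\eta_i(\theta))}{\phi_i}\Big\}b_i(x,\phi_i),\qquad x\in\mathcal X_i\subseteq[0,\infty),$$ with dispersion parameter $\phi_i>0$, canonical parameter $\eta_i(\theta)$ and cumulant function $\kappa_i$. Let $S=\sum_{j=1}^nX_j$, $\mathcal L_S(t)=\mathbb E[e^{-tS}]$ and $\mathcal L_i^*(t)=\mathbb E[X_ie^{-tS}]$. Then for all $t>0$ such that $\eta_j(\theta)-\phi_jt$ lies in the domain of $\kappa_j$ for all $j\in\{1,\dots,n\}$ and $\mu_\Theta$-almost every $\theta$, and every $i\in\{1,\dots,n\}$, $$\mathcal L_S(t)=\int_{[0,\infty)}\exp\Big\{\sum_{j=1}^n\frac{\kappa_j(\eta_j(\theta)-\phi_jt)-\kappa_j(\eta_j(\theta))}{\phi_j}\Big\}\mu_\Theta(\mathrm d\theta),$$ $$\mathcal L_i^*(t)=\int_{[0,\infty)}\kappa_i'(\eta_i(\theta)-\phi_it)\exp\Big\{\sum_{j=1}^n\frac{\kappa_j(\eta_j(\theta)-\phi_jt)-\kappa_j(\eta_j(\theta))}{\phi_j}\Big\}\mu_\Theta(\mathrm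 d\theta).$$
   Context: The pairs $(b_i,\kappa_i)$ satisfy the standard exponential dispersion family regularity conditions. That is, densities are with respect to a fixed $\sigma$-finite dominating measure $m_i$ on $\mathcal X_i$, $b_i(\cdot,\phi_i)\ge 0$, the domain of $\kappa_i$ is the set of real $\eta$ with $\int_{\mathcal X_i}e^{x\eta/\phi_i}b_i(x,\phi_i)\,m_i(\mathrm dx)<\infty$, and on this domain $\kappa_i(\eta)=\phi_i\log\int_{\mathcal X_i}e^{x\eta/\phi_i}b_i(x,\phi_i)\,m_i(\mathrm dx)$. The canonical parameter $\eta_i(\theta)$ lies in the domain of $\kappa_i$. Consequently $\mathbb E[e^{uX_i}\mid\Theta=\theta]=\exp\{(\kappa_i(\eta_i(\theta)+\phi_iu)-\kappa_i(\eta_i(\theta)))/\phi_i\}$ whenever $\eta_i(\theta)+\phi_iu$ lies in the domain of $\kappa_i$. Conditional expectations given $\Theta=\theta$ are taken with respect to a regular conditional distribution of $(X_1,\dots,X_n)$ given $\Theta$. *)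

theory Defs
  imports "HOL-Probability.Probability"
begin

text \<open>Here m is the dominating measure and b the base function, whose second argument is the
  dispersion parameter.\<close>

definition edf_domain :: "real measure \<Rightarrow> (real \<Rightarrow> real \<Rightarrow> real) \<Rightarrow> real \<Rightarrow> real set" where
  "edf_domain m b \<phi> = {\<eta>. (\<integral>\<^sup>+ x. ennreal (exp (x * \<eta> / \<phi>) * b x \<phi>) \<partial>m) < \<infinity>}"

text \<open>The value is meaningful only for \<open>\<eta>\<close> in the domain.\<close>

definition edf_cumulant :: "real measure \<Rightarrow> (real \<Rightarrow> real \<Rightarrow> real) \<Rightarrow> real \<Rightarrow> real \<Rightarrow> real" where
  "edf_cumulant m b \<phi> \<eta> = \<phi> * ln (LINT x|m. exp (x * \<eta> / \<phi>) * b x \<phi>)"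

definition edf_density ::
    "real measure \<Rightarrow> (real \<Rightarrow> real \<Rightarrow> real) \<Rightarrow> real \<Rightarrow> real \<Rightarrow> real \<Rightarrow> real" where
  "edf_density m b \<phi> \<eta> x = exp ((x * \<eta> - edf_cumulant m b \<phi> \<eta>) / \<phi>) * b x \<phi>"

text \<open>The state space is an arbitrary subset of the half-line with its trace Borel sigma-algebra.
  No condition is imposed on \<open>b\<close> at dispersion parameters other than \<open>\<phi>\<close>.\<close>

definition edf_base ::
    "real set \<Rightarrow> real measure \<Rightarrow> (real \<Rightarrow> real \<Rightarrow> real) \<Rightarrow> real \<Rightarrow> bool" where
  "edf_base \<X> m b \<phi> \<longleftrightarrow>
     \<X> \<subseteq> {0..} \<and> sets m = sets (restrict_space borel \<X>) \<and> sigma_finite_measure m \<and>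
     (\<lambda>x. b x \<phi>) \<in> borel_measurable m \<and> (\<forall>x\<in>\<X>. b x \<phi> \<ge> 0)"

text \<open>The law on the real line of a variable with the above density: the density lives on the
  trace space of \<open>\<X>\<close>, so it is pushed forward along the inclusion.\<close>

definition edf_law ::
    "real measure \<Rightarrow> (real \<Rightarrow> real \<Rightarrow> real) \<Rightarrow> real \<Rightarrow> real \<Rightarrow> real measure" where
  "edf_law m b \<phi> \<eta> = distr (density m (\<lambda>x. ennreal (edf_density m b \<phi> \<eta> x))) borel (\<lambda>x. x)"

text \<open>\<open>K\<close> is a regular conditional distribution of \<open>Y\<close> given \<open>Z\<close> under \<open>M\<close>.\<close>

definition regular_cond_distr ::
    "'a measure \<Rightarrow> 'c measure \<Rightarrow> ('a \<Rightarrow> 'c) \<Rightarrow> 'b measure \<Rightarrow> ('a \<Rightarrow> 'b) \<Rightarrow> ('c \<Rightarrow> 'b measure) \<Rightarrow> bool"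
  where
  "regular_cond_distr M L Z N Y K \<longleftrightarrow>
     K \<in> L \<rightarrow>\<^sub>M prob_algebra N \<and>
     (\<forall>A\<in>sets L. \<forall>B\<in>sets N.
        emeasure M {\<omega> \<in> space M. Z \<omega> \<in> A \<and> Y \<omega> \<in> B}
          = (\<integral>\<^sup>+ z. emeasure (K z) B * indicator A z \<partial>(distr M L Z)))"

text \<open>Conditional independence given a sub-sigma-algebra \<open>F\<close>, modelled on
  \<^const>\<open>prob_space.indep_vars\<close>.\<close>

definition cond_indep_vars ::
    "'a measure \<Rightarrow> 'a measure \<Rightarrow> ('i \<Rightarrow> 'b measure) \<Rightarrow> ('i \<Rightarrow> 'a \<Rightarrow> 'b) \<Rightarrow> 'i set \<Rightarrow> bool" where
  "cond_indep_vars M F N X I \<longleftrightarrow>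
     (\<forall>i\<in>I. X i \<in> M \<rightarrow>\<^sub>M N i) \<and>
     (\<forall>J A. J \<subseteq> I \<longrightarrow> J \<noteq> {} \<longrightarrow> finite J \<longrightarrow> (\<forall>i\<in>J. A i \<in> sets (N i)) \<longrightarrow>
        (AE \<omega> in M.
           real_cond_exp M F (indicator {\<omega> \<in> space M. \<forall>i\<in>J. X i \<omega> \<in> A i}) \<omega>
             = (\<Prod>i\<in>J. real_cond_exp M F (indicator {\<omega> \<in> space M. X i \<omega> \<in> A i}) \<omega>)))"

end

(* Given Theta, the kernel K is almost surely the product of its marginals, by testing conditional
   independence on the countably many rectangles with rational corners. Integrating a product of
   functions of the X j therefore amounts to integrating a product of one-dimensional EDF integrals
   against the law of Theta. For x -> exp (- t x) such an integral is a quotient of normalizing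
   constants. For x -> x exp (- t x) it is the derivative of a normalizing constant at a point strictly
   to the left of a point of the domain, where differentiation under the integral is justified by
   dominated convergence because the state space lies in the half-line. *)

theory Submission
  imports Defs
begin

section \<open>Finite measures on a product of real lines are determined by countably many
  rectangles\<close>

text \<open>Each open half-line is a countable union of closed half-lines with rational endpoints. A
  countable generator is wanted so that statements holding almost everywhere for each generating set
  hold simultaneously outside one null set.\<close>

lemma borel_eq_atMost_rat: "(borel :: real measure) = sigma UNIV (range (\<lambda>q. {..of_rat q}))"
proof (rule borel_eq_sigmaI1[OF borel_Iio])
  fix A :: "real set" assume "A \<in> range lessThan"
  then obtain a where a: "A = {..<a}" by auto
  have "A = (\<Union>q\<in>{q. of_rat q < a}. {..of_rat q})"
  proof (intro equalityI subsetI)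
    fix x assume "x \<in> A"
    then obtain q where "x < of_rat q" "of_rat q < a"
      using of_rat_dense[of x a] a by auto
    then show "x \<in> (\<Union>q\<in>{q. of_rat q < a}. {..of_rat q})"
      by (auto intro!: exI[of _ q])
  qed (auto simp: a)
  also have "\<dots> \<in> sets (sigma UNIV (range (\<lambda>q. {..of_rat q})))"
    by (intro sets.countable_UN') auto
  finally show "A \<in> sets (sigma UNIV (range (\<lambda>q. {..of_rat q})))" .
qed auto

lemma real_le_rat: "\<exists>q. (x :: real) \<le> of_rat q"
  using of_rat_dense[of x "x + 1"] by (meson less_add_one less_imp_le)

text \<open>The rectangles \<open>R q\<close> form a countable family that covers the space and
  generates its sigma-algebra. It is stable under intersection, since intersecting two of them takes
  the smaller corner in each coordinate. Uniqueness of measures on such a generator then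
  applies.\<close>

lemma measure_eqI_PiM_borel_rat:
  fixes P Q :: "('i \<Rightarrow> real) measure"
  assumes I: "finite I" and P: "finite_measure P" "sets P = sets (PiM I (\<lambda>_. borel))"
    and Q: "sets Q = sets (PiM I (\<lambda>_. borel))"
    and eq: "\<And>q. q \<in> (I \<rightarrow>\<^sub>E UNIV) \<Longrightarrow>
      emeasure P (\<Pi>\<^sub>E i\<in>I. {..of_rat (q i)}) = emeasure Q (\<Pi>\<^sub>E i\<in>I. {..of_rat (q i)})"
  shows "P = Q"
proof -
  interpret P: finite_measure P by fact
  define R where "R q = (\<Pi>\<^sub>E i\<in>I. {..of_rat (q i) :: real})" for q
  let ?G = "R ` (I \<rightarrow>\<^sub>E UNIV)"
  \<comment> \<open>\<open>G\<close> is the same family in the shape that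
    \<open>sets_PiM_sigma\<close> expects, with \<open>I\<close> as the only block of
    indices.\<close>
  define G where "G = {{f \<in> I \<rightarrow>\<^sub>E UNIV. \<forall>i\<in>j. f i \<in> A i} |A j.
    j \<in> {I} \<and> A \<in> Pi j (\<lambda>_. range (\<lambda>q. {..of_rat q :: real}))}"
  have G: "G = ?G"
  proof (intro equalityI subsetI)
    fix S assume "S \<in> G"
    then obtain A where A: "A \<in> Pi I (\<lambda>_. range (\<lambda>q. {..of_rat q :: real}))"
      and S: "S = {f \<in> I \<rightarrow>\<^sub>E UNIV. \<forall>i\<in>I. f i \<in> A i}"
      by (auto simp: G_def)
    from A have "\<forall>i\<in>I. \<exists>q. A i = {..of_rat q :: real}" by auto
    then obtain q where q: "\<forall>i\<in>I. A i = {..of_rat (q i)}" by metis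
    have "S = R (restrict q I)"
      unfolding S R_def using q by (auto simp: PiE_iff extensional_def)
    then show "S \<in> ?G" by auto
  next
    fix S assume "S \<in> ?G"
    then obtain q where "S = R q" by auto
    then have "S = {f \<in> I \<rightarrow>\<^sub>E UNIV. \<forall>i\<in>I. f i \<in> {..of_rat (q i)}}"
      by (auto simp: R_def PiE_iff extensional_def)
    then show "S \<in> G" unfolding G_def
      by (intro CollectI exI[of _ "\<lambda>i. {..of_rat (q i)}"] exI[of _ I]) auto
  qed
  have cover: "\<exists>S\<subseteq>range (\<lambda>q. {..of_rat q :: real}). countable S \<and> UNIV = \<Union>S"
  proof (intro exI[of _ "range (\<lambda>q. {..of_rat q :: real})"] conjI)
    show "UNIV = \<Union> (range (\<lambda>q. {..of_rat q :: real}))"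
      using real_le_rat by fastforce
  qed auto
  have "sets (PiM I (\<lambda>_. sigma UNIV (range (\<lambda>q. {..of_rat q :: real})))) = sets (sigma (I \<rightarrow>\<^sub>E UNIV) G)"
    unfolding G_def by (rule sets_PiM_sigma) (use I cover in auto)
  then have sets: "sets (PiM I (\<lambda>_. borel :: real measure)) = sigma_sets (I \<rightarrow>\<^sub>E UNIV) ?G"
    unfolding borel_eq_atMost_rat[symmetric] G by (simp add: R_def image_subset_iff PiE_mono)
  show ?thesis
  proof (rule measure_eqI_generator_eq_countable)
    show "Int_stable ?G"
    proof (rule Int_stableI_image)
      fix p q :: "'i \<Rightarrow> rat"
      have "of_rat (min a b) = min (of_rat a) (of_rat b :: real)" for a b
        by (simp add: min_def of_rat_less_eq)
      then have "R p \<inter> R q = R (\<lambda>i\<in>I. min (p i) (q i))"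
        by (auto simp: R_def PiE_iff extensional_def)
      then show "\<exists>r\<in>I \<rightarrow>\<^sub>E UNIV. R p \<inter> R q = R r" by auto
    qed
    show "?G \<subseteq> Pow (I \<rightarrow>\<^sub>E UNIV)" by (auto simp: R_def PiE_iff extensional_def)
    show "countable ?G" using I by (intro countable_image countable_PiE) auto
    show "\<Union>?G = I \<rightarrow>\<^sub>E UNIV"
    proof (intro equalityI subsetI)
      fix x :: "'i \<Rightarrow> real" assume x: "x \<in> I \<rightarrow>\<^sub>E UNIV"
      have "\<forall>i. \<exists>q. x i \<le> of_rat q" using real_le_rat by blast
      from choice[OF this] obtain q where "\<forall>i. x i \<le> of_rat (q i)" by blast
      with x have "x \<in> R (restrict q I)" by (auto simp: R_def PiE_iff extensional_def)
      then show "x \<in> \<Union>?G" by auto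
    qed (auto simp: R_def PiE_iff extensional_def)
    show "emeasure P S = emeasure Q S" if "S \<in> ?G" for S
      using that eq unfolding R_def by blast
    show "sets P = sigma_sets (I \<rightarrow>\<^sub>E UNIV) ?G" "sets Q = sigma_sets (I \<rightarrow>\<^sub>E UNIV) ?G"
      using P Q sets by simp_all
  qed simp_all
qed

section \<open>Regular conditional distributions and conditional independence\<close>

text \<open>The sets of the sigma-algebra generated by \<open>Z\<close> are exactly the preimages of
  sets of \<open>L\<close>, so the defining identity of the kernel is the averaging property that
  characterizes conditional expectation. This connects \<open>cond_indep_vars\<close>, phrased with
  \<open>real_cond_exp\<close>, to the kernel.\<close>

lemma cond_prob_regular_cond_distr:
  assumes "prob_space M" and Z: "Z \<in> M \<rightarrow>\<^sub>M L" and Y: "Y \<in> M \<rightarrow>\<^sub>M N"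
    and K: "regular_cond_distr M L Z N Y K" and B: "B \<in> sets N"
  shows "AE \<omega> in M. real_cond_exp M (vimage_algebra (space M) Z L)
    (indicator {\<omega> \<in> space M. Y \<omega> \<in> B}) \<omega> = measure (K (Z \<omega>)) B"
proof -
  interpret prob_space M by fact
  let ?F = "vimage_algebra (space M) Z L"
  have Zs: "Z \<in> space M \<rightarrow> space L" using Z by (auto dest: measurable_space)
  have sub: "subalgebra M ?F"
    using Z by (auto simp: subalgebra_def sets_vimage_algebra2[OF Zs])
  interpret finite_measure_subalgebra M ?F
    by unfold_locales (fact sub)
  note Z[measurable] Y[measurable] B[measurable]
  have K1: "K \<in> L \<rightarrow>\<^sub>M prob_algebra N" and K2: "\<And>A. A \<in> sets L \<Longrightarrow>
      emeasure M {\<omega> \<in> space M. Z \<omega> \<in> A \<and> Y \<omega> \<in> B}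
          = (\<integral>\<^sup>+ z. emeasure (K z) B * indicator A z \<partial>(distr M L Z))"
    using K B by (auto simp: regular_cond_distr_def)
  have K3[measurable]: "K \<in> L \<rightarrow>\<^sub>M subprob_algebra N"
    using K1 by (rule measurable_prob_algebraD)
  have sp: "subprob_space (K z)" if "z \<in> space L" for z
    using measurable_space[OF K3 that] by (simp add: space_subprob_algebra)
  have m1: "(\<lambda>z. measure (K z) B) \<in> borel_measurable L" by measurable
  have m2[measurable]: "(\<lambda>\<omega>. measure (K (Z \<omega>)) B) \<in> borel_measurable M" by measurable
  show ?thesis
  proof (rule real_cond_exp_charact)
    show "(\<lambda>\<omega>. measure (K (Z \<omega>)) B) \<in> borel_measurable ?F"
      using measurable_compose[OF measurable_vimage_algebra1[OF Zs] m1] .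
    show "integrable M (\<lambda>\<omega>. measure (K (Z \<omega>)) B)"
      by (rule integrable_const_bound[where B=1])
        (auto intro!: AE_I2 subprob_space.subprob_measure_le_1 sp measurable_space[OF Z])
    show "integrable M (indicator {\<omega> \<in> space M. Y \<omega> \<in> B} :: 'a \<Rightarrow> real)"
      by (intro integrable_real_indicator) (auto simp: less_top[symmetric])
    fix A assume "A \<in> sets ?F"
    then obtain A' where A'[measurable]: "A' \<in> sets L" and A: "A = Z -` A' \<inter> space M"
      by (auto simp: sets_vimage_algebra2[OF Zs])
    have "(LINT \<omega>:A|M. indicator {\<omega> \<in> space M. Y \<omega> \<in> B} \<omega> :: real)
        = (LINT \<omega>|M. indicator {\<omega> \<in> space M. Z \<omega> \<in> A' \<and> Y \<omega> \<in> B} \<omega>)"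
      unfolding set_lebesgue_integral_def A
      by (intro Bochner_Integration.integral_cong) (auto simp: indicator_def)
    also have "\<dots> = measure M {\<omega> \<in> space M. Z \<omega> \<in> A' \<and> Y \<omega> \<in> B}"
      by (simp add: Int_def conj_ac)
    \<comment> \<open>The defining identity of the kernel is one between extended nonnegative
      numbers; \<open>enn2real\<close> carries it over to the real integrals.\<close>
    also have "\<dots> = enn2real (\<integral>\<^sup>+ z. emeasure (K z) B * indicator A' z \<partial>(distr M L Z))"
      by (simp add: measure_def K2)
    also have "\<dots> = enn2real (\<integral>\<^sup>+ \<omega>. emeasure (K (Z \<omega>)) B * indicator A' (Z \<omega>) \<partial>M)"
      by (subst nn_integral_distr) auto
    also have "\<dots> = enn2real (\<integral>\<^sup>+ \<omega>. ennreal (indicator A \<omega> * measure (K (Z \<omega>)) B) \<partial>M)"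
    proof (intro arg_cong[where f=enn2real] nn_integral_cong)
      fix \<omega> assume w: "\<omega> \<in> space M"
      then interpret subprob_space "K (Z \<omega>)" using sp measurable_space[OF Z] by blast
      show "emeasure (K (Z \<omega>)) B * indicator A' (Z \<omega>) = ennreal (indicator A \<omega> * measure (K (Z \<omega>)) B)"
        using w by (auto simp: A indicator_def emeasure_eq_measure)
    qed
    also have "\<dots> = (LINT \<omega>:A|M. measure (K (Z \<omega>)) B)"
      unfolding set_lebesgue_integral_def
      by (subst integral_eq_nn_integral) (auto simp: A)
    finally show "(LINT \<omega>:A|M. indicator {\<omega> \<in> space M. Y \<omega> \<in> B} \<omega>)
      = (LINT \<omega>:A|M. measure (K (Z \<omega>)) B)" .
  qed
qed

text \<open>Each rectangle brings its own exceptional null set. As \<open>I\<close> is finite, there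
  are only countably many rational corners, and the union of these null sets is null. Off it,
  \<open>K z\<close> and the product of its marginals agree on a generator.\<close>

lemma cond_indep_vars_AE_PiM:
  fixes X :: "'i \<Rightarrow> 'a \<Rightarrow> real"
  assumes M: "prob_space M" and Z: "Z \<in> M \<rightarrow>\<^sub>M L" and I: "finite I"
    and ind: "cond_indep_vars M (vimage_algebra (space M) Z L) (\<lambda>_. borel) X I"
    and K: "regular_cond_distr M L Z (PiM I (\<lambda>_. borel)) (\<lambda>\<omega>. \<lambda>i\<in>I. X i \<omega>) K"
  shows "AE z in distr M L Z. K z = PiM I (\<lambda>i. distr (K z) borel (\<lambda>x. x i))"
proof -
  interpret prob_space M by fact
  let ?N = "PiM I (\<lambda>_. borel :: real measure)"
  let ?F = "vimage_algebra (space M) Z L"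
  have X: "X i \<in> borel_measurable M" if "i \<in> I" for i
    using ind that by (auto simp: cond_indep_vars_def)
  have Y: "(\<lambda>\<omega>. \<lambda>i\<in>I. X i \<omega>) \<in> M \<rightarrow>\<^sub>M ?N"
    using X by (intro measurable_restrict)
  have K1: "K \<in> L \<rightarrow>\<^sub>M prob_algebra ?N"
    using K by (auto simp: regular_cond_distr_def)
  have K3[measurable]: "K \<in> L \<rightarrow>\<^sub>M subprob_algebra ?N"
    using K1 by (rule measurable_prob_algebraD)
  note Z[measurable]
  have Kp: "prob_space (K z)" "sets (K z) = sets ?N" if "z \<in> space L" for z
    using measurable_space[OF K1 that] by (auto simp: space_prob_algebra)
  define R where "R q = (\<Pi>\<^sub>E i\<in>I. {..of_rat (q i) :: real})" for q
  have R[measurable]: "R q \<in> sets ?N" for q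
    unfolding R_def using I by (intro sets_PiM_I_finite) auto
  \<comment> \<open>The mass of this cylinder under \<open>K z\<close> is the mass that the
    \<open>i\<close>-th marginal gives to a half-line.\<close>
  define H where "H i r = {x \<in> space ?N. x i \<in> {..of_rat r :: real}}" for i r
  have H[measurable]: "H i r \<in> sets ?N" if "i \<in> I" for i r
    unfolding H_def using that by measurable
  have AEq: "AE z in distr M L Z. measure (K z) (R q) = (\<Prod>i\<in>I. measure (K z) (H i (q i)))" for q
  \<comment> \<open>\<open>cond_indep_vars\<close> speaks of nonempty index sets only. For empty
    \<open>I\<close> both sides equal 1.\<close>
  proof (cases "I = {}")
    case True
    have "R q = space ?N" using True by (simp add: R_def space_PiM)
    then have "measure (K z) (R q) = 1" if "z \<in> space L" for z
      using prob_space.prob_space[OF Kp(1)[OF that]] sets_eq_imp_space_eq[OF Kp(2)[OF that]] by simp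
    then show ?thesis using True by (intro AE_I2) simp
  next
    case False
    have 1: "AE \<omega> in M. real_cond_exp M ?F (indicator {\<omega> \<in> space M. \<forall>i\<in>I. X i \<omega> \<in> {..of_rat (q i)}}) \<omega>
       = (\<Prod>i\<in>I. real_cond_exp M ?F (indicator {\<omega> \<in> space M. X i \<omega> \<in> {..of_rat (q i)}}) \<omega>)"
      using ind[unfolded cond_indep_vars_def, THEN conjunct2, rule_format, of I "\<lambda>i. {..of_rat (q i)}"]
        False I by simp
    have e: "{\<omega> \<in> space M. (\<lambda>i\<in>I. X i \<omega>) \<in> R q} = {\<omega> \<in> space M. \<forall>i\<in>I. X i \<omega> \<in> {..of_rat (q i)}}"
      by (auto simp: R_def PiE_iff extensional_def)
    have 2: "AE \<omega> in M. real_cond_exp M ?F (indicator {\<omega> \<in> space M. \<forall>i\<in>I. X i \<omega> \<in> {..of_rat (q i)}}) \<omega>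
        = measure (K (Z \<omega>)) (R q)"
      using cond_prob_regular_cond_distr[OF M Z Y K R[of q]] unfolding e .
    have "AE \<omega> in M. real_cond_exp M ?F (indicator {\<omega> \<in> space M. X i \<omega> \<in> {..of_rat (q i)}}) \<omega>
        = measure (K (Z \<omega>)) (H i (q i))" if "i \<in> I" for i
    proof -
      have "{\<omega> \<in> space M. (\<lambda>i\<in>I. X i \<omega>) \<in> H i (q i)} = {\<omega> \<in> space M. X i \<omega> \<in> {..of_rat (q i)}}"
        using that by (auto simp: H_def space_PiM)
      then show ?thesis
        using cond_prob_regular_cond_distr[OF M Z Y K H[OF that, of "q i"]] by simp
    qed
    then have 3: "AE \<omega> in M. \<forall>i\<in>I. real_cond_exp M ?F (indicator {\<omega> \<in> space M. X i \<omega> \<in> {..of_rat (q i)}}) \<omega>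
        = measure (K (Z \<omega>)) (H i (q i))"
      using I by (simp add: AE_finite_all)
    have "AE \<omega> in M. measure (K (Z \<omega>)) (R q) = (\<Prod>i\<in>I. measure (K (Z \<omega>)) (H i (q i)))"
      using 1 2 3 by eventually_elim simp
    then show ?thesis
      by (subst AE_distr_iff) (auto intro!: Z)
  qed
  have "AE z in distr M L Z. \<forall>q\<in>I \<rightarrow>\<^sub>E UNIV. measure (K z) (R q) = (\<Prod>i\<in>I. measure (K z) (H i (q i)))"
    using AEq I by (subst AE_ball_countable) (auto intro!: countable_PiE)
  moreover have "AE z in distr M L Z. z \<in> space L"
    by (rule AE_I2) simp
  ultimately show ?thesis
  proof eventually_elim
    case (elim z)
    interpret K: prob_space "K z" using Kp elim by blast
    note sK[measurable_cong] = Kp(2)[OF elim(2)]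
    have [measurable]: "(\<lambda>x. x i) \<in> K z \<rightarrow>\<^sub>M borel" if "i \<in> I" for i
      by (subst measurable_cong_sets[OF Kp(2)[OF elim(2)] refl]) (rule measurable_component_singleton[OF that])
    \<comment> \<open>The locale \<open>product_prob_space\<close> asks for a probability measure at
      every index, so the family is padded with a point mass outside \<open>I\<close>.\<close>
    let ?D = "\<lambda>i. if i \<in> I then distr (K z) borel (\<lambda>x. x i) else return borel 0"
    have ps: "prob_space (?D i)" for i
      by (auto intro!: K.prob_space_distr prob_space_return)
    interpret product_prob_space ?D I
      by (intro product_prob_spaceI ps)
    have "K z = PiM I ?D"
    proof (rule measure_eqI_PiM_borel_rat[OF I])
      show "finite_measure (K z)" by unfold_locales
      show "sets (PiM I ?D) = sets ?N" by (intro sets_PiM_cong) auto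
      fix q assume q: "q \<in> I \<rightarrow>\<^sub>E (UNIV :: rat set)"
      have "emeasure (PiM I ?D) (R q) = (\<Prod>i\<in>I. emeasure (?D i) {..of_rat (q i)})"
        unfolding R_def using I by (intro emeasure_PiM) auto
      also have "\<dots> = (\<Prod>i\<in>I. ennreal (measure (K z) (H i (q i))))"
      proof (intro prod.cong refl)
        fix i assume i: "i \<in> I"
        have "(\<lambda>x. x i) -` {..of_rat (q i)} \<inter> space (K z) = H i (q i)"
          using sets_eq_imp_space_eq[OF sK] by (auto simp: H_def)
        then show "emeasure (?D i) {..of_rat (q i)} = ennreal (measure (K z) (H i (q i)))"
          using i by (simp add: emeasure_distr K.emeasure_eq_measure)
      qed
      also have "\<dots> = emeasure (K z) (R q)"
        using elim q by (simp add: prod_ennreal K.emeasure_eq_measure)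
      finally show "emeasure (K z) (\<Pi>\<^sub>E i\<in>I. {..of_rat (q i)})
        = emeasure (PiM I ?D) (\<Pi>\<^sub>E i\<in>I. {..of_rat (q i)})"
        by (simp add: R_def)
    qed (simp add: sK)
    also have "\<dots> = PiM I (\<lambda>i. distr (K z) borel (\<lambda>x. x i))"
      by (intro PiM_cong) auto
    finally show ?case .
  qed
qed

text \<open>This is the defining identity of the kernel with the whole space \<open>space L\<close>
  as conditioning event.\<close>

lemma distr_eq_bind_regular_cond_distr:
  assumes "prob_space M" and Z: "Z \<in> M \<rightarrow>\<^sub>M L" and Y: "Y \<in> M \<rightarrow>\<^sub>M N"
    and K: "regular_cond_distr M L Z N Y K"
  shows "distr M N Y = distr M L Z \<bind> K"
proof (rule measure_eqI)
  interpret prob_space M by fact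
  have K1: "K \<in> L \<rightarrow>\<^sub>M subprob_algebra N"
    using K by (auto simp: regular_cond_distr_def intro: measurable_prob_algebraD)
  \<comment> \<open>On an empty space \<open>bind\<close> is a mere default. Here \<open>Z\<close>
    sends a point of the nonempty \<open>space M\<close> into \<open>space L\<close>.\<close>
  have ne: "space L \<noteq> {}" using Z not_empty by (auto dest: measurable_space)
  show s: "sets (distr M N Y) = sets (distr M L Z \<bind> K)"
    using ne K1 by (subst sets_bind[where N=N]) (auto dest: sets_kernel)
  fix B assume "B \<in> sets (distr M N Y)"
  then have B: "B \<in> sets N" by simp
  have "{\<omega> \<in> space M. Z \<omega> \<in> space L \<and> Y \<omega> \<in> B} = Y -` B \<inter> space M"
    using Z by (auto dest: measurable_space)
  moreover have "emeasure M {\<omega> \<in> space M. Z \<omega> \<in> space L \<and> Y \<omega> \<in> B}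
     = (\<integral>\<^sup>+ z. emeasure (K z) B * indicator (space L) z \<partial>(distr M L Z))"
    using K B by (auto simp: regular_cond_distr_def)
  moreover have "\<dots> = (\<integral>\<^sup>+ z. emeasure (K z) B \<partial>(distr M L Z))"
    by (intro nn_integral_cong) auto
  ultimately show "emeasure (distr M N Y) B = emeasure (distr M L Z \<bind> K) B"
    using Y B ne K1 by (simp add: emeasure_distr emeasure_bind[where N=N])
qed

text \<open>The law of the vector is the mixture of the kernels, and almost every kernel is a
  product measure, so Tonelli factorizes the inner integral. Working in \<open>ennreal\<close>
  avoids integrability conditions. The measurability claim serves later to replace integrands that
  are known only almost everywhere.\<close>

lemma
  fixes X :: "'i \<Rightarrow> 'a \<Rightarrow> real" and g :: "'i \<Rightarrow> real \<Rightarrow> ennreal"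
  assumes M: "prob_space M" and Z: "Z \<in> M \<rightarrow>\<^sub>M L" and I: "finite I"
    and ind: "cond_indep_vars M (vimage_algebra (space M) Z L) (\<lambda>_. borel) X I"
    and K: "regular_cond_distr M L Z (PiM I (\<lambda>_. borel)) (\<lambda>\<omega>. \<lambda>i\<in>I. X i \<omega>) K"
    and g: "\<And>i. i \<in> I \<Longrightarrow> g i \<in> borel_measurable borel"
  shows measurable_prod_nn_integral_regular_cond_distr:
      "(\<lambda>z. \<Prod>i\<in>I. \<integral>\<^sup>+x. g i x \<partial>distr (K z) borel (\<lambda>x. x i)) \<in> borel_measurable L"
    and nn_integral_prod_cond_indep:
      "(\<integral>\<^sup>+\<omega>. (\<Prod>i\<in>I. g i (X i \<omega>)) \<partial>M)
        = (\<integral>\<^sup>+z. (\<Prod>i\<in>I. \<integral>\<^sup>+x. g i x \<partial>distr (K z) borel (\<lambda>x. x i)) \<partial>distr M L Z)"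
proof -
  interpret prob_space M by fact
  let ?N = "PiM I (\<lambda>_. borel :: real measure)"
  have K1: "K \<in> L \<rightarrow>\<^sub>M prob_algebra ?N"
    using K by (auto simp: regular_cond_distr_def)
  have K3[measurable]: "K \<in> L \<rightarrow>\<^sub>M subprob_algebra ?N"
    using K1 by (rule measurable_prob_algebraD)
  have Kp: "prob_space (K z)" "sets (K z) = sets ?N" if "z \<in> space L" for z
    using measurable_space[OF K1 that] by (auto simp: space_prob_algebra)
  have X: "X i \<in> borel_measurable M" if "i \<in> I" for i
    using ind that by (auto simp: cond_indep_vars_def)
  have Y: "(\<lambda>\<omega>. \<lambda>i\<in>I. X i \<omega>) \<in> M \<rightarrow>\<^sub>M ?N"
    using X by (intro measurable_restrict)
  note g[measurable]
  have G: "(\<lambda>x. \<Prod>i\<in>I. g i (x i)) \<in> borel_measurable ?N"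
    by measurable
  have D: "(\<integral>\<^sup>+x. g i x \<partial>distr (K z) borel (\<lambda>x. x i)) = (\<integral>\<^sup>+x. g i (x i) \<partial>K z)"
    if "i \<in> I" "z \<in> space L" for i z
  proof -
    note Kp(2)[OF that(2), measurable_cong]
    show ?thesis using that by (subst nn_integral_distr) auto
  qed
  have m: "(\<lambda>z. \<Prod>i\<in>I. \<integral>\<^sup>+x. g i (x i) \<partial>K z) \<in> borel_measurable L"
  proof (intro borel_measurable_prod_ennreal)
    fix i assume [measurable]: "i \<in> I"
    show "(\<lambda>z. \<integral>\<^sup>+x. g i (x i) \<partial>K z) \<in> borel_measurable L"
      by (rule measurable_compose[OF K3 nn_integral_measurable_subprob_algebra]) measurable
  qed
  show "(\<lambda>z. \<Prod>i\<in>I. \<integral>\<^sup>+x. g i x \<partial>distr (K z) borel (\<lambda>x. x i)) \<in> borel_measurable L"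
    using m by (rule measurable_cong[THEN iffD1, rotated]) (auto simp: D intro!: prod.cong)
  have "(\<integral>\<^sup>+\<omega>. (\<Prod>i\<in>I. g i (X i \<omega>)) \<partial>M) = (\<integral>\<^sup>+x. (\<Prod>i\<in>I. g i (x i)) \<partial>distr M ?N (\<lambda>\<omega>. \<lambda>i\<in>I. X i \<omega>))"
    using Y G by (subst nn_integral_distr) (auto intro!: nn_integral_cong prod.cong)
  also have "\<dots> = (\<integral>\<^sup>+z. (\<integral>\<^sup>+x. (\<Prod>i\<in>I. g i (x i)) \<partial>K z) \<partial>distr M L Z)"
    unfolding distr_eq_bind_regular_cond_distr[OF M Z Y K]
    by (rule nn_integral_bind[OF G]) (simp add: K3)
  also have "\<dots> = (\<integral>\<^sup>+z. (\<Prod>i\<in>I. \<integral>\<^sup>+x. g i x \<partial>distr (K z) borel (\<lambda>x. x i)) \<partial>distr M L Z)"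
  proof (rule nn_integral_cong_AE)
    have "AE z in distr M L Z. z \<in> space L" by (rule AE_I2) simp
    with cond_indep_vars_AE_PiM[OF M Z I ind K]
    show "AE z in distr M L Z. (\<integral>\<^sup>+x. (\<Prod>i\<in>I. g i (x i)) \<partial>K z)
      = (\<Prod>i\<in>I. \<integral>\<^sup>+x. g i x \<partial>distr (K z) borel (\<lambda>x. x i))"
    proof eventually_elim
      case (elim z)
      interpret K: prob_space "K z" using Kp elim by blast
      note Kp(2)[OF elim(2), measurable_cong]
      have [measurable]: "(\<lambda>x. x i) \<in> K z \<rightarrow>\<^sub>M borel" if "i \<in> I" for i
        by (subst measurable_cong_sets[OF Kp(2)[OF elim(2)] refl]) (rule measurable_component_singleton[OF that])
      \<comment> \<open>Padding by a point mass outside \<open>I\<close>, for the same reason as in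
        \<open>cond_indep_vars_AE_PiM\<close>.\<close>
      let ?D = "\<lambda>i. if i \<in> I then distr (K z) borel (\<lambda>x. x i) else return borel 0"
      interpret product_prob_space ?D I
        by (intro product_prob_spaceI) (auto intro!: K.prob_space_distr prob_space_return)
      have "K z = PiM I ?D"
        by (subst elim(1)) (intro PiM_cong, auto)
      then have "(\<integral>\<^sup>+x. (\<Prod>i\<in>I. g i (x i)) \<partial>K z) = (\<integral>\<^sup>+x. (\<Prod>i\<in>I. g i (x i)) \<partial>PiM I ?D)"
        by simp
      also have "\<dots> = (\<Prod>i\<in>I. integral\<^sup>N (?D i) (g i))"
        by (rule product_nn_integral_prod[OF I]) auto
      finally show ?case by (auto intro!: prod.cong)
    qed
  qed
  finally show "(\<integral>\<^sup>+\<omega>. (\<Prod>i\<in>I. g i (X i \<omega>)) \<partial>M)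
        = (\<integral>\<^sup>+z. (\<Prod>i\<in>I. \<integral>\<^sup>+x. g i x \<partial>distr (K z) borel (\<lambda>x. x i)) \<partial>distr M L Z)" .
qed

section \<open>Integrals against a completion, and differentiation of Laplace-type integrals\<close>

text \<open>The mixed integrands of the theorem involve \<eta>, which comes without Borel
  measurability in \<theta>. They agree almost everywhere with a measurable function
  \<open>g\<close> obtained from the kernel, which makes them measurable for the completion and
  fixes their integral.\<close>

lemma integral_completion_eq_enn2real:
  fixes f :: "'a \<Rightarrow> real"
  assumes g: "g \<in> borel_measurable M" and fg: "AE x in M. g x = ennreal (f x)"
    and f: "AE x in M. 0 \<le> f x"
  shows "(LINT x|completion M. f x) = enn2real (\<integral>\<^sup>+x. g x \<partial>M)"
proof -
  have eq: "AE x in M. enn2real (g x) = f x"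
    using fg f by eventually_elim simp
  have m: "f \<in> borel_measurable (completion M)"
  proof (rule measurableI)
    fix A :: "real set" assume A: "A \<in> sets borel"
    have "(\<lambda>x. enn2real (g x)) -` A \<inter> space M \<in> sets M"
      using g A by measurable
    then have 1: "(\<lambda>x. enn2real (g x)) -` A \<inter> space M \<in> sets (completion M)"
      by (rule sets_completionI_sets)
    \<comment> \<open>The two preimages differ only inside a null set, and the completion contains
      all subsets of null sets.\<close>
    have 2: "AE x in completion M. x \<in> (\<lambda>x. enn2real (g x)) -` A \<inter> space M \<longleftrightarrow> x \<in> f -` A \<inter> space M"
      using AE_completion[OF eq] by eventually_elim auto
    show "f -` A \<inter> space (completion M) \<in> sets (completion M)"
      using completion.in_sets_AE[OF 2 1] by simp
  qed simp
  have "(\<integral>\<^sup>+x. ennreal (f x) \<partial>completion M) = (\<integral>\<^sup>+x. g x \<partial>M)"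
    unfolding nn_integral_completion using fg by (intro nn_integral_cong_AE) auto
  then show ?thesis
    using integral_eq_nn_integral[OF m AE_completion[OF f]] by simp
qed

text \<open>The gap between \<open>s\<close> and \<open>c\<close> leaves room for an integrable
  function that dominates all difference quotients with small increment, so dominated convergence
  allows differentiation under the integral.\<close>

lemma
  fixes g f :: "'a \<Rightarrow> real"
  assumes [measurable]: "g \<in> borel_measurable M" "f \<in> borel_measurable M"
    and g: "\<And>x. x \<in> space M \<Longrightarrow> 0 \<le> g x" and f: "\<And>x. x \<in> space M \<Longrightarrow> 0 \<le> f x"
    and int: "integrable M (\<lambda>x. exp (c * g x) * f x)" and s: "s < c"
  shows integrable_deriv_exp_mult: "integrable M (\<lambda>x. g x * exp (s * g x) * f x)"
    and DERIV_integral_exp_mult: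
      "((\<lambda>s. LINT x|M. exp (s * g x) * f x) has_real_derivative
         (LINT x|M. g x * exp (s * g x) * f x)) (at s)"
proof -
  \<comment> \<open>As \<open>g\<close> is nonnegative, integrability at \<open>c\<close> passes to
    every smaller exponent.\<close>
  have int_le: "integrable M (\<lambda>x. exp (u * g x) * f x)" if "u \<le> c" for u
    by (rule Bochner_Integration.integrable_bound[OF int])
      (auto intro!: AE_I2 mult_right_mono g f that simp: abs_mult)
  \<comment> \<open>Half of the gap lets the parameter move by up to \<open>d\<close>; the other
    half absorbs the factor \<open>y\<close> through \<open>d * y \<le> exp (d * y)\<close>.\<close>
  define d where "d = (c - s) / 2"
  have d: "d > 0" "s + 2 * d = c" using s by (auto simp: d_def field_simps)
  have key: "y * exp ((s + d) * y) \<le> exp (c * y) / d" if "y \<ge> 0" for y :: real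
  proof -
    have "d * y \<le> exp (d * y)" using exp_ge_add_one_self[of "d * y"] by linarith
    then have "d * y * exp ((s + d) * y) \<le> exp (d * y) * exp ((s + d) * y)"
      by (intro mult_right_mono) auto
    also have "\<dots> = exp (c * y)"
      unfolding exp_add[symmetric] d(2)[symmetric] by (simp add: algebra_simps)
    finally show ?thesis using d by (simp add: field_simps)
  qed
  have w: "integrable M (\<lambda>x. exp (c * g x) * f x / d)" using int by simp
  show "integrable M (\<lambda>x. g x * exp (s * g x) * f x)"
  proof (rule Bochner_Integration.integrable_bound[OF w])
    have "g x * exp (s * g x) * f x \<le> exp (c * g x) * f x / d" if x: "x \<in> space M" for x
    proof -
      have "g x * exp (s * g x) \<le> g x * exp ((s + d) * g x)"
        using g[OF x] d by (intro mult_left_mono) (auto intro!: mult_right_mono)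
      also have "\<dots> \<le> exp (c * g x) / d" using key g x by blast
      finally show ?thesis using mult_right_mono[OF _ f[OF x]] by fastforce
    qed
    then show "AE x in M. norm (g x * exp (s * g x) * f x) \<le> norm (exp (c * g x) * f x / d)"
      using g f d by (intro AE_I2) (simp add: abs_mult)
  qed measurable
  show "((\<lambda>s. LINT x|M. exp (s * g x) * f x) has_real_derivative
         (LINT x|M. g x * exp (s * g x) * f x)) (at s)"
    \<comment> \<open>The limit is tested along sequences of increments, because dominated
      convergence is a statement about sequences.\<close>
    unfolding DERIV_def tendsto_at_iff_sequentially comp_def
  proof (intro allI impI)
    fix h :: "nat \<Rightarrow> real" assume h0: "\<forall>i. h i \<in> UNIV - {0}" and h: "h \<longlonglongrightarrow> 0"
    have nz: "h i \<noteq> 0" for i using h0 by auto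
    let ?q = "\<lambda>i x. (exp ((s + h i) * g x) * f x - exp (s * g x) * f x) / h i"
    have "\<forall>\<^sub>F i in sequentially. \<bar>h i\<bar> < d"
      using order_tendstoD(2)[OF tendsto_rabs_zero[OF h] d(1)] .
    \<comment> \<open>The domination holds only for increments below \<open>d\<close>, so the first
      \<open>N\<close> terms are dropped; \<open>LIMSEQ_offset\<close> restores them at the
      end.\<close>
    then obtain N where N: "\<And>i. i \<ge> N \<Longrightarrow> \<bar>h i\<bar> < d" by (auto simp: eventually_sequentially)
    have bound: "\<bar>?q (i + N) x\<bar> \<le> exp (c * g x) * f x / d" if x: "x \<in> space M" for i x
    proof -
      let ?h = "h (i + N)"
      have hd: "\<bar>?h\<bar> < d" using N by simp
      \<comment> \<open>Mean value bound on the interval of radius \<open>d\<close> around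
        \<open>s\<close>: the derivative in \<open>z\<close> is nondecreasing because
        \<open>g x\<close> is nonnegative, so its value at \<open>s + d\<close> bounds it.\<close>
      have mvt: "\<bar>exp ((s + ?h) * g x) - exp (s * g x)\<bar> \<le> g x * exp ((s + d) * g x) * \<bar>?h\<bar>"
      proof -
        have "norm (exp ((s + ?h) * g x) - exp (s * g x)) \<le> g x * exp ((s + d) * g x) * norm ((s + ?h) - s)"
        proof (rule field_differentiable_bound[where S="{s - d..s + d}"])
          fix z assume z: "z \<in> {s - d..s + d}"
          show "((\<lambda>z. exp (z * g x)) has_field_derivative g x * exp (z * g x)) (at z within {s - d..s + d})"
            by (auto intro!: derivative_eq_intros)
          show "norm (g x * exp (z * g x)) \<le> g x * exp ((s + d) * g x)"
            using g[OF x] z by (auto simp: abs_mult intro!: mult_left_mono mult_right_mono)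
        qed (use hd d in auto)
        then show ?thesis by simp
      qed
      have "\<bar>?q (i + N) x\<bar> = \<bar>exp ((s + ?h) * g x) - exp (s * g x)\<bar> * f x / \<bar>?h\<bar>"
        using f[OF x] by (simp add: abs_mult abs_divide left_diff_distrib[symmetric])
      also have "\<dots> \<le> g x * exp ((s + d) * g x) * \<bar>?h\<bar> * f x / \<bar>?h\<bar>"
        using mvt f[OF x] by (intro divide_right_mono mult_right_mono) auto
      also have "\<dots> = g x * exp ((s + d) * g x) * f x" using nz[of "i + N"] by simp
      also have "\<dots> \<le> exp (c * g x) / d * f x"
        using key[OF g[OF x]] f[OF x] by (intro mult_right_mono)
      finally show ?thesis by simp
    qed
    have "(\<lambda>i. LINT x|M. ?q (i + N) x) \<longlonglongrightarrow> (LINT x|M. g x * exp (s * g x) * f x)"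
    proof (rule integral_dominated_convergence[OF _ _ w])
      show "AE x in M. (\<lambda>i. ?q (i + N) x) \<longlonglongrightarrow> g x * exp (s * g x) * f x"
      proof (rule AE_I2)
        fix x
        have "((\<lambda>z. exp (z * g x) * f x) has_real_derivative g x * exp (s * g x) * f x) (at s)"
          by (auto intro!: derivative_eq_intros)
        then have "(\<lambda>i. ?q i x) \<longlonglongrightarrow> g x * exp (s * g x) * f x"
          unfolding DERIV_def tendsto_at_iff_sequentially comp_def using h0 h by blast
        then show "(\<lambda>i. ?q (i + N) x) \<longlonglongrightarrow> g x * exp (s * g x) * f x"
          by (rule LIMSEQ_ignore_initial_segment)
      qed
      show "AE x in M. norm (?q (i + N) x) \<le> exp (c * g x) * f x / d" for i
        using bound by (intro AE_I2) simp
    qed measurable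
    moreover have "(LINT x|M. ?q (i + N) x) =
       ((LINT x|M. exp ((s + h (i + N)) * g x) * f x) - (LINT x|M. exp (s * g x) * f x)) / h (i + N)" for i
    proof -
      have "s + h (i + N) \<le> c" using N[of "i + N"] d by auto
      then show ?thesis using int_le s by simp
    qed
    ultimately have "(\<lambda>i. ((LINT x|M. exp ((s + h (i + N)) * g x) * f x) - (LINT x|M. exp (s * g x) * f x)) / h (i + N))
       \<longlonglongrightarrow> (LINT x|M. g x * exp (s * g x) * f x)" by (simp only:)
    then show "(\<lambda>i. ((LINT x|M. exp ((s + h i) * g x) * f x) - (LINT x|M. exp (s * g x) * f x)) / h i)
       \<longlonglongrightarrow> (LINT x|M. g x * exp (s * g x) * f x)"
      by (rule LIMSEQ_offset)
  qed
qed

section \<open>Exponential dispersion families: normalizing constants and exponential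
  integrals\<close>

lemma edf_baseD:
  assumes "edf_base \<X> m b \<phi>"
  shows "space m \<subseteq> {0..}" "\<And>x. x \<in> space m \<Longrightarrow> 0 \<le> b x \<phi>" "(\<lambda>x. b x \<phi>) \<in> borel_measurable m"
    "(\<lambda>x. x) \<in> m \<rightarrow>\<^sub>M borel"
proof -
  have s: "sets m = sets (restrict_space borel \<X>)" using assms by (simp add: edf_base_def)
  from sets_eq_imp_space_eq[OF s] have "space m = \<X>" by (simp add: space_restrict_space)
  then show "space m \<subseteq> {0..}" "\<And>x. x \<in> space m \<Longrightarrow> 0 \<le> b x \<phi>" "(\<lambda>x. b x \<phi>) \<in> borel_measurable m"
    using assms by (auto simp: edf_base_def)
  show "(\<lambda>x. x) \<in> m \<rightarrow>\<^sub>M borel"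
    unfolding measurable_cong_sets[OF s refl] by (rule measurable_restrict_space1) simp
qed

lemma integrable_edf_domain:
  assumes "edf_base \<X> m b \<phi>" "\<eta> \<in> edf_domain m b \<phi>"
  shows "integrable m (\<lambda>x. exp (\<eta> * (x / \<phi>)) * b x \<phi>)"
proof (rule integrableI_nonneg)
  note edf_baseD(3,4)[OF assms(1), measurable]
  show "(\<lambda>x. exp (\<eta> * (x / \<phi>)) * b x \<phi>) \<in> borel_measurable m" by measurable
qed (use assms edf_baseD(2)[OF assms(1)] in \<open>auto simp: edf_domain_def mult.commute\<close>)

text \<open>The factor with the cumulant does not depend on \<open>x\<close> and leaves the
  integral. Nonnegativity of \<open>h\<close> on the half-line is enough, since
  \<open>space m\<close> lies there; this admits \<open>h x = x * exp (- t * x)\<close>.\<close>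

lemma nn_integral_edf_law:
  assumes base: "edf_base \<X> m b \<phi>" and h[measurable]: "h \<in> borel_measurable borel"
    and h0: "\<And>x. 0 \<le> x \<Longrightarrow> 0 \<le> h x"
    and int: "integrable m (\<lambda>x. h x * exp (\<eta> * (x / \<phi>)) * b x \<phi>)"
  shows "(\<integral>\<^sup>+x. ennreal (h x) \<partial>edf_law m b \<phi> \<eta>)
    = ennreal (exp (- edf_cumulant m b \<phi> \<eta> / \<phi>) * (LINT x|m. h x * exp (\<eta> * (x / \<phi>)) * b x \<phi>))"
proof -
  note edf_baseD(3,4)[OF base, measurable]
  have [measurable]: "edf_density m b \<phi> \<eta> \<in> borel_measurable m"
    unfolding edf_density_def by measurable
  have pos: "0 \<le> h x * exp (\<eta> * (x / \<phi>)) * b x \<phi>" if "x \<in> space m" for x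
    using that edf_baseD(1,2)[OF base] h0 by (auto simp: subset_eq)
  have "(\<integral>\<^sup>+x. ennreal (h x) \<partial>edf_law m b \<phi> \<eta>)
      = (\<integral>\<^sup>+x. ennreal (edf_density m b \<phi> \<eta> x) * ennreal (h x) \<partial>m)"
    unfolding edf_law_def by (subst nn_integral_distr; (subst nn_integral_density)?) auto
  also have "\<dots> = (\<integral>\<^sup>+x. ennreal (exp (- edf_cumulant m b \<phi> \<eta> / \<phi>) * (h x * exp (\<eta> * (x / \<phi>)) * b x \<phi>)) \<partial>m)"
  proof (rule nn_integral_cong)
    fix x assume x: "x \<in> space m"
    have "edf_density m b \<phi> \<eta> x = exp (- edf_cumulant m b \<phi> \<eta> / \<phi>) * exp (\<eta> * (x / \<phi>)) * b x \<phi>"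
      unfolding edf_density_def exp_add[symmetric] by (simp add: diff_divide_distrib mult.commute)
    moreover have "0 \<le> h x" "0 \<le> b x \<phi>"
      using x edf_baseD(1,2)[OF base] h0 by (auto simp: subset_eq)
    ultimately show "ennreal (edf_density m b \<phi> \<eta> x) * ennreal (h x)
      = ennreal (exp (- edf_cumulant m b \<phi> \<eta> / \<phi>) * (h x * exp (\<eta> * (x / \<phi>)) * b x \<phi>))"
      by (simp add: ennreal_mult'[symmetric] ac_simps)
  qed
  also have "\<dots> = ennreal (LINT x|m. exp (- edf_cumulant m b \<phi> \<eta> / \<phi>) * (h x * exp (\<eta> * (x / \<phi>)) * b x \<phi>))"
    using int pos by (intro nn_integral_eq_integral) (auto intro!: AE_I2)
  also have "(LINT x|m. exp (- edf_cumulant m b \<phi> \<eta> / \<phi>) * (h x * exp (\<eta> * (x / \<phi>)) * b x \<phi>))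
    = exp (- edf_cumulant m b \<phi> \<eta> / \<phi>) * (LINT x|m. h x * exp (\<eta> * (x / \<phi>)) * b x \<phi>)"
    by (rule integral_mult_right_zero)
  finally show ?thesis .
qed

text \<open>The exponent is grouped as the parameter times \<open>x / \<phi>\<close>, matching
  \<open>DERIV_integral_exp_mult\<close> with \<open>g x = x / \<phi>\<close>.\<close>

lemma edf_cumulant_alt: "edf_cumulant m b \<phi> \<eta> = \<phi> * ln (LINT x|m. exp (\<eta> * (x / \<phi>)) * b x \<phi>)"
  by (simp add: edf_cumulant_def mult.commute)

text \<open>The exponential never vanishes, so a zero integral at \<open>\<eta>'\<close> would force
  the base function to vanish almost everywhere, and the law at \<eta> would have total mass 0.
  Positivity is what makes \<open>exp\<close> undo the \<open>ln\<close> in the cumulant.\<close>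

lemma edf_normalizer_pos:
  assumes base: "edf_base \<X> m b \<phi>" and \<eta>: "\<eta> \<in> edf_domain m b \<phi>" "\<eta>' \<in> edf_domain m b \<phi>"
    and P: "prob_space (edf_law m b \<phi> \<eta>)"
  shows "0 < (LINT x|m. exp (\<eta>' * (x / \<phi>)) * b x \<phi>)"
proof -
  interpret P: prob_space "edf_law m b \<phi> \<eta>" by fact
  have b: "x \<in> space m \<Longrightarrow> 0 \<le> b x \<phi>" for x using edf_baseD(2)[OF base] .
  have ge: "0 \<le> (LINT x|m. exp (\<eta>' * (x / \<phi>)) * b x \<phi>)"
    using b by (intro Bochner_Integration.integral_nonneg) simp
  have "(LINT x|m. exp (\<eta>' * (x / \<phi>)) * b x \<phi>) \<noteq> 0"
  proof
    assume "(LINT x|m. exp (\<eta>' * (x / \<phi>)) * b x \<phi>) = 0"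
    then have "AE x in m. exp (\<eta>' * (x / \<phi>)) * b x \<phi> = 0"
      using b integrable_edf_domain[OF base \<eta>(2)]
      by (subst integral_nonneg_eq_0_iff_AE[symmetric]) auto
    then have "(LINT x|m. exp (\<eta> * (x / \<phi>)) * b x \<phi>) = 0"
      by (intro integral_eq_zero_AE) auto
    then have "(\<integral>\<^sup>+x. ennreal 1 \<partial>edf_law m b \<phi> \<eta>) = 0"
      using integrable_edf_domain[OF base \<eta>(1)] by (subst nn_integral_edf_law[OF base]) auto
    then show False by (simp add: P.emeasure_space_1)
  qed
  with ge show ?thesis by linarith
qed

text \<open>Multiplying by \<open>exp (- t * x)\<close> shifts the canonical parameter by
  \<open>- \<phi> * t\<close>, which produces the normalizing constant at the shifted
  parameter.\<close>

lemma nn_integral_exp_edf_law: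
  assumes base: "edf_base \<X> m b \<phi>" and \<phi>: "\<phi> > 0"
    and \<eta>: "\<eta> \<in> edf_domain m b \<phi>" "\<eta> - \<phi> * t \<in> edf_domain m b \<phi>"
    and P: "prob_space (edf_law m b \<phi> \<eta>)"
  shows "(\<integral>\<^sup>+x. ennreal (exp (- t * x)) \<partial>edf_law m b \<phi> \<eta>)
    = ennreal (exp ((edf_cumulant m b \<phi> (\<eta> - \<phi> * t) - edf_cumulant m b \<phi> \<eta>) / \<phi>))"
proof -
  have e: "exp (- t * x) * exp (\<eta> * (x / \<phi>)) * b x \<phi> = exp ((\<eta> - \<phi> * t) * (x / \<phi>)) * b x \<phi>" for x
    unfolding exp_add[symmetric] using \<phi> by (simp add: field_simps)
  note pos = edf_normalizer_pos[OF base \<eta> P]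
  have "(\<integral>\<^sup>+x. ennreal (exp (- t * x)) \<partial>edf_law m b \<phi> \<eta>)
    = ennreal (exp (- edf_cumulant m b \<phi> \<eta> / \<phi>) * (LINT x|m. exp ((\<eta> - \<phi> * t) * (x / \<phi>)) * b x \<phi>))"
    using integrable_edf_domain[OF base \<eta>(2)] by (subst nn_integral_edf_law[OF base]) (auto simp only: e, auto)
  also have "(LINT x|m. exp ((\<eta> - \<phi> * t) * (x / \<phi>)) * b x \<phi>) = exp (edf_cumulant m b \<phi> (\<eta> - \<phi> * t) / \<phi>)"
    unfolding edf_cumulant_alt using pos \<phi> by simp
  finally show ?thesis
    by (simp add: exp_add[symmetric] diff_divide_distrib)
qed

text \<open>With \<open>Z\<close> the normalizing constant as a function of the parameter, the
  cumulant is \<open>\<phi> * ln (Z s)\<close>, so its derivative is \<phi> times the logarithmic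
  derivative of \<open>Z\<close>. Nonnegativity comes from the state space lying in the
  half-line.\<close>

lemma
  assumes base: "edf_base \<X> m b \<phi>" and \<phi>: "\<phi> > 0" and t: "t > 0"
    and \<eta>: "\<eta> \<in> edf_domain m b \<phi>" "\<eta> - \<phi> * t \<in> edf_domain m b \<phi>"
    and P: "prob_space (edf_law m b \<phi> \<eta>)"
  shows deriv_edf_cumulant_nonneg: "0 \<le> deriv (edf_cumulant m b \<phi>) (\<eta> - \<phi> * t)"
    and nn_integral_mult_exp_edf_law: "(\<integral>\<^sup>+x. ennreal (x * exp (- t * x)) \<partial>edf_law m b \<phi> \<eta>)
      = ennreal (deriv (edf_cumulant m b \<phi>) (\<eta> - \<phi> * t) *
          exp ((edf_cumulant m b \<phi> (\<eta> - \<phi> * t) - edf_cumulant m b \<phi> \<eta>) / \<phi>))"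
proof -
  let ?s = "\<eta> - \<phi> * t"
  define Z where "Z = (\<lambda>s. LINT x|m. exp (s * (x / \<phi>)) * b x \<phi>)"
  \<comment> \<open>Differentiating in the parameter brings down \<open>x / \<phi>\<close> rather
    than \<open>x\<close>; the \<phi> in front of the logarithm compensates for this.\<close>
  define Z' where "Z' = (LINT x|m. x / \<phi> * exp (?s * (x / \<phi>)) * b x \<phi>)"
  note edf_baseD(3,4)[OF base, measurable]
  have m: "(\<lambda>x. x / \<phi>) \<in> borel_measurable m" by measurable
  have x0: "x \<in> space m \<Longrightarrow> 0 \<le> x / \<phi>" for x using edf_baseD(1)[OF base] \<phi> by auto
  note b0 = edf_baseD(2)[OF base]
  \<comment> \<open>Here \<open>t > 0\<close> is decisive: \<open>?s\<close> lies strictly to the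
    left of \<eta>, which takes the part of \<open>c\<close> in the differentiation lemma.\<close>
  have less: "?s < \<eta>" using \<phi> t by simp
  note Laplace = m edf_baseD(3)[OF base] x0 b0 integrable_edf_domain[OF base \<eta>(1)] less
  have pos: "0 < Z ?s" unfolding Z_def by (rule edf_normalizer_pos[OF base \<eta> P])
  have "(Z has_real_derivative Z') (at ?s)"
    unfolding Z_def Z'_def by (rule DERIV_integral_exp_mult[OF Laplace])
  then have "((\<lambda>s. \<phi> * ln (Z s)) has_real_derivative \<phi> * (Z' / Z ?s)) (at ?s)"
    using pos by (auto intro!: derivative_eq_intros)
  moreover have K: "edf_cumulant m b \<phi> = (\<lambda>s. \<phi> * ln (Z s))"
    by (auto simp: edf_cumulant_alt Z_def)
  ultimately have D: "deriv (edf_cumulant m b \<phi>) ?s = \<phi> * (Z' / Z ?s)"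
    by (simp add: DERIV_imp_deriv)
  have "0 \<le> Z'" unfolding Z'_def
    using x0 b0 by (intro Bochner_Integration.integral_nonneg mult_nonneg_nonneg) auto
  then show "0 \<le> deriv (edf_cumulant m b \<phi>) ?s"
    unfolding D using pos \<phi> by simp
  have e: "x * exp (- t * x) * exp (\<eta> * (x / \<phi>)) * b x \<phi>
      = \<phi> * (x / \<phi> * exp (?s * (x / \<phi>)) * b x \<phi>)" for x
  proof -
    have "exp (- t * x) * exp (\<eta> * (x / \<phi>)) = exp (?s * (x / \<phi>))"
      unfolding exp_add[symmetric] using \<phi> by (simp add: field_simps)
    then show ?thesis using \<phi> by (simp add: mult.assoc)
  qed
  have "integrable m (\<lambda>x. x * exp (- t * x) * exp (\<eta> * (x / \<phi>)) * b x \<phi>)"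
    unfolding e by (intro integrable_mult_right) (rule integrable_deriv_exp_mult[OF Laplace])
  then have "(\<integral>\<^sup>+x. ennreal (x * exp (- t * x)) \<partial>edf_law m b \<phi> \<eta>)
    = ennreal (exp (- edf_cumulant m b \<phi> \<eta> / \<phi>)
        * (LINT x|m. x * exp (- t * x) * exp (\<eta> * (x / \<phi>)) * b x \<phi>))"
    by (subst nn_integral_edf_law[OF base]) auto
  also have "(LINT x|m. x * exp (- t * x) * exp (\<eta> * (x / \<phi>)) * b x \<phi>) = \<phi> * Z'"
    unfolding e Z'_def by (rule integral_mult_right_zero)
  also have "\<phi> * Z' = deriv (edf_cumulant m b \<phi>) ?s * exp (edf_cumulant m b \<phi> ?s / \<phi>)"
    unfolding D fun_cong[OF K, of ?s] using pos \<phi> by simp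
  finally show "(\<integral>\<^sup>+x. ennreal (x * exp (- t * x)) \<partial>edf_law m b \<phi> \<eta>)
      = ennreal (deriv (edf_cumulant m b \<phi>) ?s *
          exp ((edf_cumulant m b \<phi> ?s - edf_cumulant m b \<phi> \<eta>) / \<phi>))"
    by (simp add: exp_diff diff_divide_distrib exp_minus field_simps)
qed

section \<open>Mixing over the law of \<Theta>\<close>

theorem proposition2:
  fixes M :: "'a measure" and \<Theta> :: "'a \<Rightarrow> real" and X :: "nat \<Rightarrow> 'a \<Rightarrow> real" and n :: nat
    and K :: "real \<Rightarrow> (nat \<Rightarrow> real) measure"
    and \<X> :: "nat \<Rightarrow> real set" and m :: "nat \<Rightarrow> real measure"
    and b :: "nat \<Rightarrow> real \<Rightarrow> real \<Rightarrow> real" and \<phi> :: "nat \<Rightarrow> real"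
    and \<eta> :: "nat \<Rightarrow> real \<Rightarrow> real" and \<kappa> :: "nat \<Rightarrow> real \<Rightarrow> real"
    and \<mu> :: "real measure" and S :: "'a \<Rightarrow> real" and t :: real
  assumes M: "prob_space M"
    and \<Theta>: "\<Theta> \<in> borel_measurable M" "AE \<omega> in M. \<Theta> \<omega> \<ge> 0"
    and \<mu>_def: "\<mu> = distr M borel \<Theta>"
    and X: "\<And>i. i \<in> {1..n} \<Longrightarrow> X i \<in> borel_measurable M"
      "\<And>i. i \<in> {1..n} \<Longrightarrow> AE \<omega> in M. X i \<omega> \<ge> 0"
    and cond_indep: "cond_indep_vars M (vimage_algebra (space M) \<Theta> borel) (\<lambda>_. borel) X {1..n}"
    and K: "regular_cond_distr M borel \<Theta> (PiM {1..n} (\<lambda>_. borel)) (\<lambda>\<omega>. \<lambda>i\<in>{1..n}. X i \<omega>) K"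
    and joint_meas: "\<And>i. i \<in> {1..n} \<Longrightarrow>
      (\<lambda>(\<theta>, s). LINT x|K \<theta>. exp (- s * x i))
        \<in> borel_measurable (restrict_space borel {0..} \<Otimes>\<^sub>M restrict_space borel {0..})"
    and \<phi>: "\<And>i. i \<in> {1..n} \<Longrightarrow> \<phi> i > 0"
    and base: "\<And>i. i \<in> {1..n} \<Longrightarrow> edf_base (\<X> i) (m i) (b i) (\<phi> i)"
    and \<kappa>_def: "\<And>i. i \<in> {1..n} \<Longrightarrow> \<kappa> i = edf_cumulant (m i) (b i) (\<phi> i)"
    and \<eta>: "AE \<theta> in \<mu>. \<forall>i\<in>{1..n}. \<eta> i \<theta> \<in> edf_domain (m i) (b i) (\<phi> i)"
    and edf: "AE \<theta> in \<mu>. \<forall>i\<in>{1..n}.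
      distr (K \<theta>) borel (\<lambda>x. x i) = edf_law (m i) (b i) (\<phi> i) (\<eta> i \<theta>)"
    and S_def: "S = (\<lambda>\<omega>. \<Sum>j=1..n. X j \<omega>)"
    and t: "t > 0"
      "AE \<theta> in \<mu>. \<forall>j\<in>{1..n}. \<eta> j \<theta> - \<phi> j * t \<in> edf_domain (m j) (b j) (\<phi> j)"
  shows "(LINT \<omega>|M. exp (- t * S \<omega>))
      = (LINT \<theta>:{0..}|completion \<mu>.
           exp (\<Sum>j=1..n. (\<kappa> j (\<eta> j \<theta> - \<phi> j * t) - \<kappa> j (\<eta> j \<theta>)) / \<phi> j))
    \<and> (\<forall>i\<in>{1..n}. (LINT \<omega>|M. X i \<omega> * exp (- t * S \<omega>))
      = (LINT \<theta>:{0..}|completion \<mu>. deriv (\<kappa> i) (\<eta> i \<theta> - \<phi> i * t) *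
           exp (\<Sum>j=1..n. (\<kappa> j (\<eta> j \<theta> - \<phi> j * t) - \<kappa> j (\<eta> j \<theta>)) / \<phi> j)))"
proof -
  interpret prob_space M by fact
  let ?I = "{1..n}"
  let ?L = "\<lambda>\<theta>. \<Sum>j=1..n. (\<kappa> j (\<eta> j \<theta> - \<phi> j * t) - \<kappa> j (\<eta> j \<theta>)) / \<phi> j"
  have K1: "K \<in> borel \<rightarrow>\<^sub>M prob_algebra (PiM ?I (\<lambda>_. borel))"
    using K by (auto simp: regular_cond_distr_def)
  \<comment> \<open>Through the hypothesis \<open>edf\<close>, this makes almost every
    \<open>edf_law\<close> a probability measure, as positivity of the normalizing constants
    requires.\<close>
  have prob: "prob_space (distr (K \<theta>) borel (\<lambda>x. x j))" if "j \<in> ?I" for \<theta> j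
  proof -
    have Kp: "prob_space (K \<theta>)" "sets (K \<theta>) = sets (PiM ?I (\<lambda>_. borel))"
      using measurable_space[OF K1, of \<theta>] by (auto simp: space_prob_algebra)
    show ?thesis
      by (rule prob_space.prob_space_distr[OF Kp(1)],
          subst measurable_cong_sets[OF Kp(2) refl], rule measurable_component_singleton[OF that])
  qed
  \<comment> \<open>Hence the restriction to \<open>{0..}\<close> in the mixed integrals changes
    nothing almost everywhere.\<close>
  have pos: "AE \<theta> in \<mu>. 0 \<le> \<theta>"
    unfolding \<mu>_def using \<Theta> by (subst AE_distr_iff) auto
  have edf_law: "AE \<theta> in \<mu>. \<forall>j\<in>?I. distr (K \<theta>) borel (\<lambda>x. x j) = edf_law (m j) (b j) (\<phi> j) (\<eta> j \<theta>)
    \<and> prob_space (edf_law (m j) (b j) (\<phi> j) (\<eta> j \<theta>))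
    \<and> \<eta> j \<theta> \<in> edf_domain (m j) (b j) (\<phi> j) \<and> \<eta> j \<theta> - \<phi> j * t \<in> edf_domain (m j) (b j) (\<phi> j)"
    using edf \<eta> t(2)
  proof eventually_elim
    case (elim \<theta>)
    then show ?case by (metis prob)
  qed
  note mixing = M \<Theta>(1) finite_atLeastAtMost cond_indep K
  have exp_S: "(\<Prod>j\<in>?I. ennreal (exp (- t * X j \<omega>))) = ennreal (exp (- t * S \<omega>))" for \<omega>
    by (simp add: S_def sum_distrib_left exp_sum prod_ennreal sum_negf[symmetric])
  have S[measurable]: "S \<in> borel_measurable M" unfolding S_def using X(1) by measurable
  have "(LINT \<omega>|M. exp (- t * S \<omega>)) = enn2real (\<integral>\<^sup>+\<omega>. (\<Prod>j\<in>?I. ennreal (exp (- t * X j \<omega>))) \<partial>M)"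
    unfolding exp_S by (rule integral_eq_nn_integral) auto
  also have "\<dots> = enn2real (\<integral>\<^sup>+\<theta>. (\<Prod>j\<in>?I. \<integral>\<^sup>+x. ennreal (exp (- t * x)) \<partial>distr (K \<theta>) borel (\<lambda>x. x j)) \<partial>\<mu>)"
    unfolding \<mu>_def by (subst nn_integral_prod_cond_indep[OF mixing, where g="\<lambda>_ x. ennreal (exp (- t * x))"]) auto
  also have "\<dots> = (LINT \<theta>:{0..}|completion \<mu>. exp (?L \<theta>))"
    unfolding set_lebesgue_integral_def
  proof (rule integral_completion_eq_enn2real[symmetric])
    show "(\<lambda>\<theta>. \<Prod>j\<in>?I. \<integral>\<^sup>+x. ennreal (exp (- t * x)) \<partial>distr (K \<theta>) borel (\<lambda>x. x j)) \<in> borel_measurable \<mu>"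
      unfolding \<mu>_def measurable_distr_eq1
      by (rule measurable_prod_nn_integral_regular_cond_distr[OF mixing]) auto
    show "AE \<theta> in \<mu>. (\<Prod>j\<in>?I. \<integral>\<^sup>+x. ennreal (exp (- t * x)) \<partial>distr (K \<theta>) borel (\<lambda>x. x j))
      = ennreal (indicator {0..} \<theta> *\<^sub>R exp (?L \<theta>))"
      using pos edf_law
    proof eventually_elim
      case (elim \<theta>)
      have "(\<integral>\<^sup>+x. ennreal (exp (- t * x)) \<partial>distr (K \<theta>) borel (\<lambda>x. x j))
          = ennreal (exp ((\<kappa> j (\<eta> j \<theta> - \<phi> j * t) - \<kappa> j (\<eta> j \<theta>)) / \<phi> j))" if j: "j \<in> ?I" for j
        using elim(2) j nn_integral_exp_edf_law[OF base[OF j] \<phi>[OF j], of "\<eta> j \<theta>" t]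
        by (simp add: \<kappa>_def[OF j])
      then have "(\<Prod>j\<in>?I. \<integral>\<^sup>+x. ennreal (exp (- t * x)) \<partial>distr (K \<theta>) borel (\<lambda>x. x j))
          = (\<Prod>j\<in>?I. ennreal (exp ((\<kappa> j (\<eta> j \<theta> - \<phi> j * t) - \<kappa> j (\<eta> j \<theta>)) / \<phi> j)))"
        by (intro prod.cong refl)
      also have "\<dots> = ennreal (exp (?L \<theta>))"
        by (simp add: prod_ennreal exp_sum)
      finally show ?case using elim(1) by simp
    qed
  qed auto
  finally have "(LINT \<omega>|M. exp (- t * S \<omega>)) = (LINT \<theta>:{0..}|completion \<mu>. exp (?L \<theta>))" .
  moreover have "(LINT \<omega>|M. X i \<omega> * exp (- t * S \<omega>))
      = (LINT \<theta>:{0..}|completion \<mu>. deriv (\<kappa> i) (\<eta> i \<theta> - \<phi> i * t) * exp (?L \<theta>))" if i: "i \<in> ?I" for i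
  proof -
    \<comment> \<open>Only the \<open>i\<close>-th factor carries the extra \<open>x\<close>, so the
      factorization over the coordinates applies again.\<close>
    define g where "g = (\<lambda>j x. ennreal (if j = i then x * exp (- t * x) else exp (- t * x)))"
    have g: "g j \<in> borel_measurable borel" for j unfolding g_def by (cases "j = i") auto
    have "(LINT \<omega>|M. X i \<omega> * exp (- t * S \<omega>)) = enn2real (\<integral>\<^sup>+\<omega>. ennreal (X i \<omega> * exp (- t * S \<omega>)) \<partial>M)"
    proof (rule integral_eq_nn_integral)
      show "(\<lambda>\<omega>. X i \<omega> * exp (- t * S \<omega>)) \<in> borel_measurable M"
        using X(1)[OF i] by measurable
      show "AE \<omega> in M. 0 \<le> X i \<omega> * exp (- t * S \<omega>)"
        using X(2)[OF i] by eventually_elim simp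
    qed
    also have "(\<integral>\<^sup>+\<omega>. ennreal (X i \<omega> * exp (- t * S \<omega>)) \<partial>M) = (\<integral>\<^sup>+\<omega>. (\<Prod>j\<in>?I. g j (X j \<omega>)) \<partial>M)"
    \<comment> \<open>The identity holds at every point: the exponential factors are nonnegative,
      and where \<open>X i\<close> is negative \<open>ennreal\<close> sends both sides to 0.\<close>
    proof (rule nn_integral_cong)
      fix \<omega>
      have "(\<Prod>j\<in>?I. g j (X j \<omega>)) = g i (X i \<omega>) * (\<Prod>j\<in>?I - {i}. g j (X j \<omega>))"
        using i by (simp add: prod.remove)
      also have "(\<Prod>j\<in>?I - {i}. g j (X j \<omega>)) = (\<Prod>j\<in>?I - {i}. ennreal (exp (- t * X j \<omega>)))"
        by (intro prod.cong) (auto simp: g_def)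
      also have "g i (X i \<omega>) * \<dots> = ennreal (X i \<omega>) * (ennreal (exp (- t * X i \<omega>)) * \<dots>)"
        by (simp add: g_def ennreal_mult'' mult.assoc)
      also have "ennreal (exp (- t * X i \<omega>)) * (\<Prod>j\<in>?I - {i}. ennreal (exp (- t * X j \<omega>)))
          = (\<Prod>j\<in>?I. ennreal (exp (- t * X j \<omega>)))"
        using i by (simp add: prod.remove)
      also have "\<dots> = ennreal (exp (- t * S \<omega>))"
        by (rule exp_S)
      finally show "ennreal (X i \<omega> * exp (- t * S \<omega>)) = (\<Prod>j\<in>?I. g j (X j \<omega>))"
        by (simp add: ennreal_mult'')
    qed
    also have "\<dots> = (\<integral>\<^sup>+\<theta>. (\<Prod>j\<in>?I. \<integral>\<^sup>+x. g j x \<partial>distr (K \<theta>) borel (\<lambda>x. x j)) \<partial>\<mu>)"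
      unfolding \<mu>_def by (rule nn_integral_prod_cond_indep[OF mixing g])
    also have "enn2real \<dots> = (LINT \<theta>:{0..}|completion \<mu>. deriv (\<kappa> i) (\<eta> i \<theta> - \<phi> i * t) * exp (?L \<theta>))"
      unfolding set_lebesgue_integral_def
    proof (rule integral_completion_eq_enn2real[symmetric])
      show "(\<lambda>\<theta>. \<Prod>j\<in>?I. \<integral>\<^sup>+x. g j x \<partial>distr (K \<theta>) borel (\<lambda>x. x j)) \<in> borel_measurable \<mu>"
        unfolding \<mu>_def measurable_distr_eq1
        by (rule measurable_prod_nn_integral_regular_cond_distr[OF mixing g])
      note \<kappa>' = nn_integral_mult_exp_edf_law[OF base[OF i] \<phi>[OF i] t(1)]
        deriv_edf_cumulant_nonneg[OF base[OF i] \<phi>[OF i] t(1)]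
      \<comment> \<open>The return from \<open>ennreal\<close> to a real integral needs a
        nonnegative integrand, hence the sign of the derivative of the cumulant.\<close>
      show "AE \<theta> in \<mu>. 0 \<le> indicator {0..} \<theta> *\<^sub>R (deriv (\<kappa> i) (\<eta> i \<theta> - \<phi> i * t) * exp (?L \<theta>))"
        using edf_law by eventually_elim (use i \<kappa>'(2) in \<open>simp add: \<kappa>_def[OF i]\<close>)
      show "AE \<theta> in \<mu>. (\<Prod>j\<in>?I. \<integral>\<^sup>+x. g j x \<partial>distr (K \<theta>) borel (\<lambda>x. x j))
        = ennreal (indicator {0..} \<theta> *\<^sub>R (deriv (\<kappa> i) (\<eta> i \<theta> - \<phi> i * t) * exp (?L \<theta>)))"
        using pos edf_law
      proof eventually_elim
        case (elim \<theta>)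
        let ?e = "\<lambda>j. exp ((\<kappa> j (\<eta> j \<theta> - \<phi> j * t) - \<kappa> j (\<eta> j \<theta>)) / \<phi> j)"
        have "(\<integral>\<^sup>+x. g j x \<partial>distr (K \<theta>) borel (\<lambda>x. x j)) = ennreal (?e j)" if j: "j \<in> ?I - {i}" for j
          using elim(2) j nn_integral_exp_edf_law[OF base \<phi>, of j "\<eta> j \<theta>" t]
          by (simp add: \<kappa>_def g_def)
        \<comment> \<open>The \<open>i\<close>-th factor is the usual exponential times the
          derivative of the cumulant; with this derivative split off, the full product of
          exponentials reappears.\<close>
        moreover have "(\<integral>\<^sup>+x. g i x \<partial>distr (K \<theta>) borel (\<lambda>x. x i))
            = ennreal (deriv (\<kappa> i) (\<eta> i \<theta> - \<phi> i * t)) * ennreal (?e i)"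
          using elim(2) i \<kappa>'(1)[of "\<eta> i \<theta>"] by (simp add: \<kappa>_def g_def ennreal_mult'')
        ultimately have "(\<Prod>j\<in>?I. \<integral>\<^sup>+x. g j x \<partial>distr (K \<theta>) borel (\<lambda>x. x j))
            = ennreal (deriv (\<kappa> i) (\<eta> i \<theta> - \<phi> i * t)) * (ennreal (?e i) * (\<Prod>j\<in>?I - {i}. ennreal (?e j)))"
          using i by (subst prod.remove[of _ i]) (auto simp: mult.assoc)
        also have "ennreal (?e i) * (\<Prod>j\<in>?I - {i}. ennreal (?e j)) = (\<Prod>j\<in>?I. ennreal (?e j))"
          using i by (subst prod.remove[of ?I i]) auto
        also have "\<dots> = ennreal (exp (?L \<theta>))"
          by (simp add: prod_ennreal exp_sum)
        finally show ?case using elim(1) by (simp add: ennreal_mult'')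
      qed
    qed
    finally show ?thesis .
  qed
  ultimately show ?thesis by blast
qed

end
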